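(* Let $X$ be a zero-dimensional Hausdorff space. The following statements are equivalent: (1) $X$ is pseudocompact. (2) $C_c(X)$ with the $U_c$-topology is a topological ring. (3) $C_c(X)$ with the $U_c$-topology is a topological vector space (over $\mathbb R$). (4) The set $W$ of all units in $C_c(X)$ is open in the $U_c$-topology.
   Context: A space is zero-dimensional if its clopen sets form a base for its topology. $X$ is pseudocompact if every real-valued continuous function on $X$ is bounded. $C_c(X)$ is the ring of real-valued continuous functions on $X$ with countable range. The $U_c$-topology on $C_c(X)$ is the topology with open base consisting of the sets $U_c(f,\epsilon)=\{g\in C_c(X): \sup_{x\in X}|f(x)-g(x)|<\epsilon\}$, $f\in C_c(X)$, $\epsilon>0$. *)

theory Defs
  imports "HOL-Analysis.Analysis" "HOL-Algebra.Module"
begin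

definition zero_dimensional_space :: "'a topology \<Rightarrow> bool" where
  "zero_dimensional_space X \<longleftrightarrow>
     openin X = arbitrary union_of (\<lambda>V. openin X V \<and> closedin X V)"

definition pseudocompact_space :: "'a topology \<Rightarrow> bool" where
  "pseudocompact_space X \<longleftrightarrow>
     (\<forall>f. continuous_map X euclideanreal f \<longrightarrow> bounded (f ` topspace X))"

(* The ring C_c(X) with pointwise operations, together with its real scalar multiplication.
   Functions on X are represented by their extensional representatives, i.e. they take the
   value undefined outside the carrier of X, so that equality in the record is equality of
   functions on X. *)
definition Cc :: "'a topology \<Rightarrow> (real, 'a \<Rightarrow> real) module" where
  "Cc X =
     \<lparr>carrier = {f \<in> extensional (topspace X).
                  continuous_map X euclideanreal f \<and> countable (f ` topspace X)},
      mult = (\<lambda>f g. \<lambda>x\<in>topspace X. f x * g x),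
      one = (\<lambda>x\<in>topspace X. 1),
      zero = (\<lambda>x\<in>topspace X. 0),
      add = (\<lambda>f g. \<lambda>x\<in>topspace X. f x + g x),
      smult = (\<lambda>c f. \<lambda>x\<in>topspace X. c * f x)\<rparr>"

(* The supremum is taken in the extended reals, since f - g may be unbounded. *)
definition Uc_nbhd :: "'a topology \<Rightarrow> ('a \<Rightarrow> real) \<Rightarrow> real \<Rightarrow> ('a \<Rightarrow> real) set" where
  "Uc_nbhd X f \<epsilon> =
     {g \<in> carrier (Cc X). (SUP x\<in>topspace X. ereal \<bar>f x - g x\<bar>) < ereal \<epsilon>}"

definition Uc_topology :: "'a topology \<Rightarrow> ('a \<Rightarrow> real) topology" where
  "Uc_topology X =
     topology (arbitrary union_of (\<lambda>U. \<exists>f\<in>carrier (Cc X). \<exists>\<epsilon>>0. U = Uc_nbhd X f \<epsilon>))"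

definition topological_ring :: "('a, 'b) ring_scheme \<Rightarrow> 'a topology \<Rightarrow> bool" where
  "topological_ring R T \<longleftrightarrow>
     ring R \<and> topspace T = carrier R \<and>
     continuous_map (prod_topology T T) T (\<lambda>(x, y). x \<oplus>\<^bsub>R\<^esub> y) \<and>
     continuous_map T T (\<lambda>x. \<ominus>\<^bsub>R\<^esub> x) \<and>
     continuous_map (prod_topology T T) T (\<lambda>(x, y). x \<otimes>\<^bsub>R\<^esub> y)"

definition real_scalars :: "real ring" where
  "real_scalars = \<lparr>carrier = UNIV, mult = (*), one = 1, zero = 0, add = (+)\<rparr>"

lemma field_real_scalars: "field real_scalars"
proof (rule cring.cring_fieldI2)
  show "cring real_scalars"
  proof (rule cringI)
    show "abelian_group real_scalars"
    proof (rule abelian_groupI)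
      show "\<exists>y\<in>carrier real_scalars. y \<oplus>\<^bsub>real_scalars\<^esub> x = \<zero>\<^bsub>real_scalars\<^esub>" for x
        by (rule bexI[of _ "- x"]) (auto simp: real_scalars_def)
    qed (auto simp: real_scalars_def)
    show "comm_monoid real_scalars"
      by (rule comm_monoidI) (auto simp: real_scalars_def)
  qed (auto simp: real_scalars_def algebra_simps)
  show "\<zero>\<^bsub>real_scalars\<^esub> \<noteq> \<one>\<^bsub>real_scalars\<^esub>"
    by (simp add: real_scalars_def)
  show "\<exists>b\<in>carrier real_scalars. a \<otimes>\<^bsub>real_scalars\<^esub> b = \<one>\<^bsub>real_scalars\<^esub>"
    if "a \<in> carrier real_scalars" "a \<noteq> \<zero>\<^bsub>real_scalars\<^esub>" for a
    using that by (intro bexI[of _ "1 / a"]) (auto simp: real_scalars_def)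
qed

definition real_topological_vector_space ::
    "(real, 'a, 'b) module_scheme \<Rightarrow> 'a topology \<Rightarrow> bool" where
  "real_topological_vector_space M T \<longleftrightarrow>
     Module.module real_scalars M \<and> topspace T = carrier M \<and>
     continuous_map (prod_topology T T) T (\<lambda>(x, y). x \<oplus>\<^bsub>M\<^esub> y) \<and>
     continuous_map (prod_topology euclideanreal T) T (\<lambda>(c, x). c \<odot>\<^bsub>M\<^esub> x)"

lemma Uc_nbhd_refine:
  assumes h: "h \<in> Uc_nbhd X f \<epsilon>"
  obtains \<delta> where "\<delta> > 0" "h \<in> Uc_nbhd X h \<delta>" "Uc_nbhd X h \<delta> \<subseteq> Uc_nbhd X f \<epsilon>"
proof -
  have "(SUP x\<in>topspace X. ereal \<bar>f x - h x\<bar>) < ereal \<epsilon>"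
    using h by (simp add: Uc_nbhd_def)
  then obtain r where r: "(SUP x\<in>topspace X. ereal \<bar>f x - h x\<bar>) < ereal r" "r < \<epsilon>"
    using ereal_dense2[of "SUP x\<in>topspace X. ereal \<bar>f x - h x\<bar>" "ereal \<epsilon>"] by auto
  have fh: "\<bar>f x - h x\<bar> \<le> r" if "x \<in> topspace X" for x
    using SUP_upper[OF that, of "\<lambda>x. ereal \<bar>f x - h x\<bar>"] r(1)
    by (metis ereal_less_eq(3) less_imp_le order_trans)
  define \<delta> where "\<delta> = (\<epsilon> - r) / 2"
  have \<delta>: "\<delta> > 0" "r + \<delta> < \<epsilon>"
    using r(2) by (auto simp: \<delta>_def field_simps)
  have "(SUP x\<in>topspace X. ereal \<bar>h x - h x\<bar>) \<le> 0"
    by (rule SUP_least) simp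
  then have "h \<in> Uc_nbhd X h \<delta>"
    using h \<delta>(1) by (auto simp: Uc_nbhd_def intro: le_less_trans)
  moreover have "g \<in> Uc_nbhd X f \<epsilon>" if g: "g \<in> Uc_nbhd X h \<delta>" for g
  proof -
    have hg: "\<bar>h x - g x\<bar> \<le> \<delta>" if "x \<in> topspace X" for x
    proof -
      have "(SUP x\<in>topspace X. ereal \<bar>h x - g x\<bar>) < ereal \<delta>"
        using g by (simp add: Uc_nbhd_def)
      with SUP_upper[OF that, of "\<lambda>x. ereal \<bar>h x - g x\<bar>"] show ?thesis
        by (metis ereal_less_eq(3) less_imp_le order_trans)
    qed
    have "(SUP x\<in>topspace X. ereal \<bar>f x - g x\<bar>) \<le> ereal (r + \<delta>)"
    proof (rule SUP_least)
      fix x assume "x \<in> topspace X"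
      from fh[OF this] hg[OF this] show "ereal \<bar>f x - g x\<bar> \<le> ereal (r + \<delta>)" by simp
    qed
    then show ?thesis
      using g \<delta>(2) by (auto simp: Uc_nbhd_def intro: le_less_trans)
  qed
  ultimately show thesis using that \<delta>(1) by blast
qed

lemma Uc_nbhd_mono: "\<delta> \<le> \<epsilon> \<Longrightarrow> Uc_nbhd X f \<delta> \<subseteq> Uc_nbhd X f \<epsilon>"
  by (auto simp: Uc_nbhd_def intro: less_le_trans)

lemma openin_Uc_topology:
  "openin (Uc_topology X) =
     arbitrary union_of (\<lambda>U. \<exists>f\<in>carrier (Cc X). \<exists>\<epsilon>>0. U = Uc_nbhd X f \<epsilon>)"
proof -
  let ?P = "\<lambda>U. \<exists>f\<in>carrier (Cc X). \<exists>\<epsilon>>0. U = Uc_nbhd X f \<epsilon>"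
  have int: "(arbitrary union_of ?P) (S \<inter> T)" if S: "?P S" and T: "?P T" for S T
  proof -
    have "\<exists>B. ?P B \<and> h \<in> B \<and> B \<subseteq> S \<inter> T" if h: "h \<in> S \<inter> T" for h
    proof -
      obtain f1 e1 f2 e2 where ST: "S = Uc_nbhd X f1 e1" "T = Uc_nbhd X f2 e2"
        using S T by blast
      obtain d1 where d1: "d1 > 0" "h \<in> Uc_nbhd X h d1" "Uc_nbhd X h d1 \<subseteq> S"
        using h ST Uc_nbhd_refine by (metis IntD1)
      obtain d2 where d2: "d2 > 0" "h \<in> Uc_nbhd X h d2" "Uc_nbhd X h d2 \<subseteq> T"
        using h ST Uc_nbhd_refine by (metis IntD2)
      have "h \<in> Uc_nbhd X h (min d1 d2)" "min d1 d2 > 0"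
        using d1 d2 by (auto simp: min_def)
      moreover have "h \<in> carrier (Cc X)"
        using d1(2) by (simp add: Uc_nbhd_def)
      moreover have "Uc_nbhd X h (min d1 d2) \<subseteq> S \<inter> T"
        using d1(3) d2(3) Uc_nbhd_mono[of "min d1 d2" d1 X h] Uc_nbhd_mono[of "min d1 d2" d2 X h]
        by auto
      ultimately show ?thesis by blast
    qed
    then show ?thesis
      by (subst arbitrary_union_of_alt) blast
  qed
  then have "istopology (arbitrary union_of ?P)"
    by (simp add: istopology_base_eq)
  then show ?thesis
    by (simp add: Uc_topology_def)
qed

lemma topspace_Uc_topology: "topspace (Uc_topology X) = carrier (Cc X)"
proof
  show "topspace (Uc_topology X) \<subseteq> carrier (Cc X)"
    unfolding topspace_def openin_Uc_topology by (auto simp: union_of_def Uc_nbhd_def)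
  show "carrier (Cc X) \<subseteq> topspace (Uc_topology X)"
  proof
    fix f assume f: "f \<in> carrier (Cc X)"
    have "(SUP x\<in>topspace X. ereal \<bar>f x - f x\<bar>) \<le> 0"
      by (rule SUP_least) simp
    then have "f \<in> Uc_nbhd X f 1"
      using f by (auto simp: Uc_nbhd_def intro: le_less_trans)
    moreover have "openin (Uc_topology X) (Uc_nbhd X f 1)"
      unfolding openin_Uc_topology
      by (rule union_of_inc) (use f in \<open>auto simp: arbitrary_def intro!: bexI[of _ f] exI[of _ 1]\<close>)
    ultimately show "f \<in> topspace (Uc_topology X)"
      using openin_subset by blast
  qed
qed

end

theory Submission
  imports Defs
begin

text \<open>
  If \<open>X\<close> is pseudocompact, all members of \<open>C\<^sub>c(X)\<close> are bounded, so the uniform topology comes from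
  a norm, and units, having bounded inverses, are bounded away from zero.  Otherwise an unbounded
  continuous function \<open>h\<close> yields points \<open>x\<^sub>n\<close> and clopen sets \<open>U\<^sub>n\<close> with
  \<open>x\<^sub>n \<in> U\<^sub>n \<subseteq> {h > n}\<close>; the sum of the functions \<open>n \<cdot> 1\<^bsub>U\<^sub>n\<^esub>\<close> is locally finite,
  hence an unbounded member \<open>g\<close> of \<open>C\<^sub>c(X)\<close>.  Multiplication of \<open>g\<close> by small constants is then
  discontinuous at \<open>0\<close>, and the unit \<open>1/(1+g)\<close> is a uniform limit of functions with zeros.
\<close>

section \<open>The algebra of continuous functions with countable range\<close>

lemma restrict_in_Cc:
  assumes "continuous_map X euclideanreal f" and "countable (f ` topspace X)"
  shows "restrict f (topspace X) \<in> carrier (Cc X)"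
proof -
  have "continuous_map X euclideanreal (restrict f (topspace X))"
    by (rule continuous_map_eq[OF assms(1)]) simp
  moreover have "restrict f (topspace X) ` topspace X = f ` topspace X"
    by (rule image_cong) auto
  ultimately show ?thesis
    using assms(2) by (simp add: Cc_def)
qed

lemma CcD:
  assumes "f \<in> carrier (Cc X)"
  shows "continuous_map X euclideanreal f" "countable (f ` topspace X)"
    "f \<in> extensional (topspace X)"
  using assms by (auto simp: Cc_def)

text \<open>The combined function factors through the product of two countable ranges. This settles
  countability for sums and products alike.\<close>

lemma countable_image_combine:
  assumes "countable (f ` A)" and "countable (g ` A)"
  shows "countable ((\<lambda>x. F (f x) (g x)) ` A)"
proof (rule countable_subset)
  show "(\<lambda>x. F (f x) (g x)) ` A \<subseteq> (\<lambda>(a, b). F a b) ` (f ` A \<times> g ` A)"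
    by auto
  show "countable ((\<lambda>(a, b). F a b) ` (f ` A \<times> g ` A))"
    by (rule countable_image[OF countable_SIGMA[OF assms]])
qed

lemma const_in_Cc: "(\<lambda>x\<in>topspace X. c) \<in> carrier (Cc X)"
proof (rule restrict_in_Cc)
  have "(\<lambda>x. c) ` topspace X \<subseteq> {c}" by auto
  then show "countable ((\<lambda>x. c) ` topspace X)"
    by (rule countable_subset) simp
qed simp

lemma add_in_Cc:
  assumes "f \<in> carrier (Cc X)" and "g \<in> carrier (Cc X)"
  shows "(\<lambda>x\<in>topspace X. f x + g x) \<in> carrier (Cc X)"
  by (rule restrict_in_Cc[OF continuous_map_add[OF assms[THEN CcD(1)]]
        countable_image_combine[OF assms[THEN CcD(2)]]])

lemma mult_in_Cc:
  assumes "f \<in> carrier (Cc X)" and "g \<in> carrier (Cc X)"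
  shows "(\<lambda>x\<in>topspace X. f x * g x) \<in> carrier (Cc X)"
  by (rule restrict_in_Cc[OF continuous_map_real_mult[OF assms[THEN CcD(1)]]
        countable_image_combine[OF assms[THEN CcD(2)]]])

lemma scale_in_Cc:
  assumes "f \<in> carrier (Cc X)"
  shows "(\<lambda>x\<in>topspace X. c * f x) \<in> carrier (Cc X)"
proof -
  have "(\<lambda>x\<in>topspace X. c * f x) = (\<lambda>x\<in>topspace X. (\<lambda>x\<in>topspace X. c) x * f x)"
    by (rule restrict_ext) simp
  then show ?thesis
    using mult_in_Cc[OF const_in_Cc assms] by metis
qed

lemma inverse_in_Cc:
  assumes "f \<in> carrier (Cc X)" and "\<And>x. x \<in> topspace X \<Longrightarrow> f x \<noteq> 0"
  shows "(\<lambda>x\<in>topspace X. inverse (f x)) \<in> carrier (Cc X)"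
proof (rule restrict_in_Cc)
  show "continuous_map X euclideanreal (\<lambda>x. inverse (f x))"
    using assms CcD(1) by (intro continuous_map_real_inverse) auto
  show "countable ((\<lambda>x. inverse (f x)) ` topspace X)"
    using countable_image[OF CcD(2)[OF assms(1)], of inverse] by (simp add: image_image)
qed

text \<open>Unfolding \<open>Cc_def\<close> would expand \<open>carrier (Cc X)\<close> as well;
  these equations touch the operations only, so the closure lemmas still match.\<close>

lemma Cc_select:
  "mult (Cc X) f g = (\<lambda>x\<in>topspace X. f x * g x)"
  "one (Cc X) = (\<lambda>x\<in>topspace X. 1)"
  "zero (Cc X) = (\<lambda>x\<in>topspace X. 0)"
  "add (Cc X) f g = (\<lambda>x\<in>topspace X. f x + g x)"
  "smult (Cc X) c f = (\<lambda>x\<in>topspace X. c * f x)"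
  by (simp_all add: Cc_def)

section \<open>Ring structure, module structure and units\<close>

lemma cring_Cc: "cring (Cc X)"
proof (rule cringI)
  show "abelian_group (Cc X)"
  proof (rule abelian_groupI)
    fix f assume f: "f \<in> carrier (Cc X)"
    show "\<exists>g\<in>carrier (Cc X). g \<oplus>\<^bsub>Cc X\<^esub> f = \<zero>\<^bsub>Cc X\<^esub>"
      by (rule bexI[OF _ scale_in_Cc[OF f, of "-1"]]) (auto simp: Cc_select intro: restrict_ext)
  \<comment> \<open>The law for zero has a bare \<open>f\<close> on one side; extensionality of
    \<open>f\<close> turns agreement on the space into equality of functions.\<close>
  qed (auto simp: Cc_select add_in_Cc const_in_Cc CcD(3) algebra_simps
        intro: restrict_ext extensionalityI)
  show "comm_monoid (Cc X)"
    by (rule comm_monoidI)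
      (auto simp: Cc_select mult_in_Cc const_in_Cc CcD(3) algebra_simps intro: restrict_ext extensionalityI)
qed (auto simp: Cc_select CcD(3) algebra_simps intro: restrict_ext extensionalityI)

text \<open>The record has no field for negation, so the pointwise formula comes from uniqueness of
  additive inverses.\<close>

lemma a_inv_Cc:
  assumes "f \<in> carrier (Cc X)"
  shows "\<ominus>\<^bsub>Cc X\<^esub> f = (\<lambda>x\<in>topspace X. - f x)"
proof -
  interpret cring "Cc X" by (rule cring_Cc)
  have "(\<lambda>x\<in>topspace X. - f x) \<in> carrier (Cc X)"
    using scale_in_Cc[OF assms, of "-1"] by simp
  moreover have "(\<lambda>x\<in>topspace X. - f x) \<oplus>\<^bsub>Cc X\<^esub> f = \<zero>\<^bsub>Cc X\<^esub>"
    by (auto simp: Cc_select intro: restrict_ext)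
  ultimately show ?thesis
    using assms minus_equality by blast
qed

lemma module_Cc: "Module.module real_scalars (Cc X)"
proof (rule moduleI)
  show "cring real_scalars"
    using field_real_scalars by (simp add: field.is_ring fieldE(1))
  show "abelian_group (Cc X)"
    by (simp add: cring.axioms(1) cring_Cc ring.is_abelian_group)
qed (auto simp: real_scalars_def Cc_select CcD(3) scale_in_Cc algebra_simps
      intro: restrict_ext extensionalityI)

text \<open>The reciprocal of a zero-free member is again continuous with countable range, so
  invertibility is a pointwise matter.\<close>

lemma Units_Cc:
  "Units (Cc X) = {f \<in> carrier (Cc X). \<forall>x\<in>topspace X. f x \<noteq> 0}"
proof (intro equalityI subsetI)
  fix f assume "f \<in> Units (Cc X)"
  then obtain g where f: "f \<in> carrier (Cc X)" and g: "g \<otimes>\<^bsub>Cc X\<^esub> f = \<one>\<^bsub>Cc X\<^esub>"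
    by (auto simp: Units_def)
  have "f x \<noteq> 0" if "x \<in> topspace X" for x
    using fun_cong[OF g, of x] that by (auto simp: Cc_select)
  with f show "f \<in> {f \<in> carrier (Cc X). \<forall>x\<in>topspace X. f x \<noteq> 0}" by blast
next
  fix f assume f: "f \<in> {f \<in> carrier (Cc X). \<forall>x\<in>topspace X. f x \<noteq> 0}"
  then have "(\<lambda>x\<in>topspace X. inverse (f x)) \<in> carrier (Cc X)"
    by (intro inverse_in_Cc) auto
  then show "f \<in> Units (Cc X)"
    using f by (auto simp: Units_def Cc_select intro!: restrict_ext bexI)
qed

section \<open>The uniform topology\<close>

lemma Uc_nbhdD:
  assumes "g \<in> Uc_nbhd X f \<epsilon>"
  shows "g \<in> carrier (Cc X)" and "x \<in> topspace X \<Longrightarrow> \<bar>f x - g x\<bar> < \<epsilon>"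
proof -
  show "g \<in> carrier (Cc X)"
    using assms by (simp add: Uc_nbhd_def)
  assume "x \<in> topspace X"
  then have "ereal \<bar>f x - g x\<bar> \<le> (SUP x\<in>topspace X. ereal \<bar>f x - g x\<bar>)"
    by (rule SUP_upper)
  also have "\<dots> < ereal \<epsilon>"
    using assms by (simp add: Uc_nbhd_def)
  finally show "\<bar>f x - g x\<bar> < \<epsilon>" by simp
qed

text \<open>Pointwise bounds below \<epsilon> only give a supremum at most \<epsilon>; the uniform
  bound \<open>r\<close> provides the slack for the strict inequality.\<close>

lemma Uc_nbhdI:
  assumes "g \<in> carrier (Cc X)" and "\<And>x. x \<in> topspace X \<Longrightarrow> \<bar>f x - g x\<bar> \<le> r" and "r < \<epsilon>"
  shows "g \<in> Uc_nbhd X f \<epsilon>"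
proof -
  have "(SUP x\<in>topspace X. ereal \<bar>f x - g x\<bar>) \<le> ereal r"
    by (rule SUP_least) (simp add: assms(2))
  then show ?thesis
    using assms by (auto simp: Uc_nbhd_def intro: le_less_trans)
qed

lemma centre_in_Uc_nbhd: "f \<in> carrier (Cc X) \<Longrightarrow> \<epsilon> > 0 \<Longrightarrow> f \<in> Uc_nbhd X f \<epsilon>"
  by (rule Uc_nbhdI[where r = 0]) auto

lemma openin_Uc_nbhd:
  assumes "f \<in> carrier (Cc X)" and "\<epsilon> > 0"
  shows "openin (Uc_topology X) (Uc_nbhd X f \<epsilon>)"
  unfolding openin_Uc_topology
  by (rule union_of_inc) (use assms in \<open>auto simp: arbitrary_def\<close>)

text \<open>A basic set can be recentred at any of its members by \<open>Uc_nbhd_refine\<close>, so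
  open sets can be tested with balls around their own points, as in a metric space.\<close>

lemma openin_Uc_iff:
  "openin (Uc_topology X) S \<longleftrightarrow>
     S \<subseteq> carrier (Cc X) \<and> (\<forall>f\<in>S. \<exists>\<epsilon>>0. Uc_nbhd X f \<epsilon> \<subseteq> S)"
proof safe
  fix f assume S: "openin (Uc_topology X) S" and "f \<in> S"
  then obtain f0 \<epsilon> where "f \<in> Uc_nbhd X f0 \<epsilon>" "Uc_nbhd X f0 \<epsilon> \<subseteq> S"
    unfolding openin_Uc_topology arbitrary_union_of_alt by blast
  then show "\<exists>\<epsilon>>0. Uc_nbhd X f \<epsilon> \<subseteq> S"
    by (metis Uc_nbhd_refine order_trans)
next
  fix f assume "openin (Uc_topology X) S" and "f \<in> S"
  then show "f \<in> carrier (Cc X)"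
    using openin_subset topspace_Uc_topology by blast
next
  assume S: "S \<subseteq> carrier (Cc X)" and nb: "\<forall>f\<in>S. \<exists>\<epsilon>>0. Uc_nbhd X f \<epsilon> \<subseteq> S"
  show "openin (Uc_topology X) S"
  proof (subst openin_subopen, intro ballI)
    fix f assume f: "f \<in> S"
    with nb obtain \<epsilon> where "\<epsilon> > 0" "Uc_nbhd X f \<epsilon> \<subseteq> S" by blast
    then show "\<exists>T. openin (Uc_topology X) T \<and> f \<in> T \<and> T \<subseteq> S"
      using f S by (intro exI[of _ "Uc_nbhd X f \<epsilon>"]) (auto simp: openin_Uc_nbhd centre_in_Uc_nbhd)
  qed
qed

section \<open>Continuity of maps into the uniform topology\<close>

lemma continuous_map_UcI:
  assumes "\<And>a. a \<in> topspace T \<Longrightarrow> F a \<in> carrier (Cc X)"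
    and "\<And>a \<epsilon>. a \<in> topspace T \<Longrightarrow> \<epsilon> > 0 \<Longrightarrow>
           \<exists>W. openin T W \<and> a \<in> W \<and> (\<forall>b\<in>W. \<forall>x\<in>topspace X. \<bar>F a x - F b x\<bar> \<le> \<epsilon>)"
  shows "continuous_map T (Uc_topology X) F"
  unfolding continuous_map_eq_topcontinuous_at topcontinuous_at_def
proof (intro ballI conjI allI impI)
  fix a S assume a: "a \<in> topspace T" and S: "openin (Uc_topology X) S \<and> F a \<in> S"
  then obtain \<epsilon> where \<epsilon>: "\<epsilon> > 0" "Uc_nbhd X (F a) \<epsilon> \<subseteq> S"
    using openin_Uc_iff by metis
  \<comment> \<open>Halving turns the non-strict pointwise estimate into a supremum strictly below
    \<epsilon>.\<close>
  with assms(2)[OF a, of "\<epsilon> / 2"] obtain W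
    where W: "openin T W" "a \<in> W" "\<forall>b\<in>W. \<forall>x\<in>topspace X. \<bar>F a x - F b x\<bar> \<le> \<epsilon> / 2"
    by auto
  have "F b \<in> S" if "b \<in> W" for b
  proof -
    have "F b \<in> carrier (Cc X)"
      using that W(1) assms(1) openin_subset by blast
    then have "F b \<in> Uc_nbhd X (F a) \<epsilon>"
      using that W \<epsilon> by (intro Uc_nbhdI[where r = "\<epsilon> / 2"]) auto
    with \<epsilon> show ?thesis by blast
  qed
  with W show "\<exists>U. openin T U \<and> a \<in> U \<and> (\<forall>b\<in>U. F b \<in> S)" by blast
qed (auto simp: topspace_Uc_topology assms(1))

text \<open>The first factor \<open>T\<close> stays arbitrary so that one criterion serves addition
  and multiplication, with \<open>T\<close> the uniform topology, and scalar multiplication, with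
  \<open>T\<close> the real line.\<close>

lemma continuous_map_Uc_prodI:
  assumes "\<And>a f. a \<in> topspace T \<Longrightarrow> f \<in> carrier (Cc X) \<Longrightarrow> F a f \<in> carrier (Cc X)"
    and "\<And>a f \<epsilon>. a \<in> topspace T \<Longrightarrow> f \<in> carrier (Cc X) \<Longrightarrow> \<epsilon> > 0 \<Longrightarrow>
           \<exists>W \<delta>. openin T W \<and> a \<in> W \<and> \<delta> > 0 \<and>
             (\<forall>b\<in>W. \<forall>g\<in>Uc_nbhd X f \<delta>. \<forall>x\<in>topspace X. \<bar>F a f x - F b g x\<bar> \<le> \<epsilon>)"
  shows "continuous_map (prod_topology T (Uc_topology X)) (Uc_topology X) (\<lambda>(a, f). F a f)"
proof (rule continuous_map_UcI)
  fix p :: "'a \<times> ('b \<Rightarrow> real)" and \<epsilon> :: real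
  assume p: "p \<in> topspace (prod_topology T (Uc_topology X))"
  then show "(case p of (a, f) \<Rightarrow> F a f) \<in> carrier (Cc X)"
    using assms(1) by (auto simp: topspace_Uc_topology)
  obtain a f where af: "p = (a, f)" "a \<in> topspace T" "f \<in> carrier (Cc X)"
    using p by (auto simp: topspace_Uc_topology)
  assume "\<epsilon> > 0"
  with assms(2) af obtain W \<delta> where W: "openin T W" "a \<in> W" "\<delta> > 0"
    "\<forall>b\<in>W. \<forall>g\<in>Uc_nbhd X f \<delta>. \<forall>x\<in>topspace X. \<bar>F a f x - F b g x\<bar> \<le> \<epsilon>"
    by metis
  then show "\<exists>W. openin (prod_topology T (Uc_topology X)) W \<and> p \<in> W \<and>
     (\<forall>q\<in>W. \<forall>x\<in>topspace X. \<bar>(case p of (a, f) \<Rightarrow> F a f) x - (case q of (a, f) \<Rightarrow> F a f) x\<bar> \<le> \<epsilon>)"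
    using af
    by (intro exI[of _ "W \<times> Uc_nbhd X f \<delta>"])
      (auto simp: openin_prod_Times_iff openin_Uc_nbhd centre_in_Uc_nbhd)
qed

text \<open>Uniform errors simply add up, whatever the size of \<open>f\<close> and
  \<open>g\<close>. Hence the whole question lies in multiplication, by functions or by
  scalars.\<close>

lemma continuous_add_Uc:
  "continuous_map (prod_topology (Uc_topology X) (Uc_topology X)) (Uc_topology X)
     (\<lambda>(f, g). f \<oplus>\<^bsub>Cc X\<^esub> g)"
proof (rule continuous_map_Uc_prodI)
  fix f g and \<epsilon> :: real
  assume "f \<in> topspace (Uc_topology X)" and g: "g \<in> carrier (Cc X)"
  then have f: "f \<in> carrier (Cc X)" by (simp add: topspace_Uc_topology)
  from f g show "f \<oplus>\<^bsub>Cc X\<^esub> g \<in> carrier (Cc X)"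
    by (simp add: Cc_select add_in_Cc)
  assume \<epsilon>: "\<epsilon> > 0"
  have "\<bar>(f \<oplus>\<^bsub>Cc X\<^esub> g) x - (f' \<oplus>\<^bsub>Cc X\<^esub> g') x\<bar> \<le> \<epsilon>"
    if "f' \<in> Uc_nbhd X f (\<epsilon>/2)" "g' \<in> Uc_nbhd X g (\<epsilon>/2)" "x \<in> topspace X" for f' g' x
  proof -
    have "\<bar>f x - f' x\<bar> < \<epsilon>/2" "\<bar>g x - g' x\<bar> < \<epsilon>/2"
      by (rule Uc_nbhdD(2)[OF that(1,3)], rule Uc_nbhdD(2)[OF that(2,3)])
    then have "\<bar>f x + g x - (f' x + g' x)\<bar> \<le> \<epsilon>"
      by linarith
    with that(3) show ?thesis by (simp add: Cc_select)
  qed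
  with f \<epsilon> show "\<exists>W \<delta>. openin (Uc_topology X) W \<and> f \<in> W \<and> \<delta> > 0 \<and>
      (\<forall>f'\<in>W. \<forall>g'\<in>Uc_nbhd X g \<delta>. \<forall>x\<in>topspace X.
         \<bar>(f \<oplus>\<^bsub>Cc X\<^esub> g) x - (f' \<oplus>\<^bsub>Cc X\<^esub> g') x\<bar> \<le> \<epsilon>)"
    by (intro exI[of _ "Uc_nbhd X f (\<epsilon>/2)"] exI[of _ "\<epsilon>/2"])
      (auto simp: openin_Uc_nbhd centre_in_Uc_nbhd)
qed

lemma continuous_a_inv_Uc:
  "continuous_map (Uc_topology X) (Uc_topology X) (\<lambda>f. \<ominus>\<^bsub>Cc X\<^esub> f)"
proof (rule continuous_map_UcI)
  fix f and \<epsilon> :: real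
  assume "f \<in> topspace (Uc_topology X)"
  then have f: "f \<in> carrier (Cc X)" by (simp add: topspace_Uc_topology)
  then show "\<ominus>\<^bsub>Cc X\<^esub> f \<in> carrier (Cc X)"
    by (simp add: abelian_group.a_inv_closed cring.axioms(1) cring_Cc ring.is_abelian_group)
  assume \<epsilon>: "\<epsilon> > 0"
  have "\<bar>(\<ominus>\<^bsub>Cc X\<^esub> f) x - (\<ominus>\<^bsub>Cc X\<^esub> g) x\<bar> \<le> \<epsilon>"
    if "g \<in> Uc_nbhd X f \<epsilon>" "x \<in> topspace X" for g x
    using Uc_nbhdD[OF that(1)] that(2) f by (fastforce simp: a_inv_Cc)
  with f \<epsilon> show "\<exists>W. openin (Uc_topology X) W \<and> f \<in> W \<and>
      (\<forall>g\<in>W. \<forall>x\<in>topspace X. \<bar>(\<ominus>\<^bsub>Cc X\<^esub> f) x - (\<ominus>\<^bsub>Cc X\<^esub> g) x\<bar> \<le> \<epsilon>)"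
    by (intro exI[of _ "Uc_nbhd X f \<epsilon>"]) (auto simp: openin_Uc_nbhd centre_in_Uc_nbhd)
qed

section \<open>Pseudocompact spaces\<close>

lemma pseudocompact_bound:
  assumes "pseudocompact_space X" and "f \<in> carrier (Cc X)"
  shows "\<exists>M>0. \<forall>x\<in>topspace X. \<bar>f x\<bar> \<le> M"
proof -
  have "bounded (f ` topspace X)"
    using assms CcD(1) by (auto simp: pseudocompact_space_def)
  then show ?thesis
    by (simp add: bounded_pos)
qed

text \<open>A single \<delta> works for all pairs in the square of radius \<open>M\<close>. Applied
  to the values of bounded functions, it gives an estimate uniform in the point of the
  space.\<close>

lemma mult_uniformly_close:
  fixes M \<epsilon> :: real
  assumes "M > 0" and "\<epsilon> > 0"
  obtains \<delta> where "\<delta> > 0"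
    "\<And>a a' b b'. \<bar>a\<bar> \<le> M \<Longrightarrow> \<bar>b\<bar> \<le> M \<Longrightarrow> \<bar>a - a'\<bar> < \<delta> \<Longrightarrow> \<bar>b - b'\<bar> < \<delta> \<Longrightarrow>
       \<bar>a * b - a' * b'\<bar> \<le> \<epsilon>"
proof -
  \<comment> \<open>The bound 1 gives \<open>\<bar>a'\<bar> \<le> M + 1\<close>; the two error terms
    are then at most \<open>\<delta> * M\<close> and \<open>(M + 1) * \<delta>\<close>, whose sum is
    \<open>(2 * M + 1) * \<delta>\<close>.\<close>
  define \<delta> where "\<delta> = min 1 (\<epsilon> / (2 * M + 1))"
  have "\<delta> \<le> \<epsilon> / (2 * M + 1)"
    by (simp add: \<delta>_def)
  with assms(1) have "(2 * M + 1) * \<delta> \<le> \<epsilon>"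
    by (simp add: pos_le_divide_eq mult.commute)
  moreover have "\<delta> > 0" "\<delta> \<le> 1"
    using assms by (auto simp: \<delta>_def)
  ultimately have \<delta>: "\<delta> > 0" "\<delta> \<le> 1" "(2 * M + 1) * \<delta> \<le> \<epsilon>"
    by blast+
  have "\<bar>a * b - a' * b'\<bar> \<le> \<epsilon>"
    if "\<bar>a\<bar> \<le> M" "\<bar>b\<bar> \<le> M" "\<bar>a - a'\<bar> < \<delta>" "\<bar>b - b'\<bar> < \<delta>" for a a' b b'
  proof -
    have "a * b - a' * b' = (a - a') * b + a' * (b - b')"
      by (simp add: algebra_simps)
    then have "\<bar>a * b - a' * b'\<bar> \<le> \<bar>a - a'\<bar> * \<bar>b\<bar> + \<bar>a'\<bar> * \<bar>b - b'\<bar>"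
      by (metis abs_mult abs_triangle_ineq)
    also have "\<dots> \<le> \<delta> * M + (M + 1) * \<delta>"
      using that \<delta> by (intro add_mono mult_mono) auto
    also have "\<dots> = (2 * M + 1) * \<delta>"
      by (simp add: algebra_simps)
    finally show ?thesis using \<delta>(3) by simp
  qed
  with \<delta>(1) that show thesis by blast
qed

lemma pseudocompact_imp_topological_ring:
  assumes "pseudocompact_space X"
  shows "topological_ring (Cc X) (Uc_topology X)"
proof -
  have "continuous_map (prod_topology (Uc_topology X) (Uc_topology X)) (Uc_topology X)
     (\<lambda>(f, g). f \<otimes>\<^bsub>Cc X\<^esub> g)"
  proof (rule continuous_map_Uc_prodI)
    fix f g and \<epsilon> :: real
    assume "f \<in> topspace (Uc_topology X)" and g: "g \<in> carrier (Cc X)"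
    then have f: "f \<in> carrier (Cc X)" by (simp add: topspace_Uc_topology)
    from f g show "f \<otimes>\<^bsub>Cc X\<^esub> g \<in> carrier (Cc X)"
      by (simp add: Cc_select mult_in_Cc)
    assume \<epsilon>: "\<epsilon> > 0"
    obtain M where M: "M > 0" "\<forall>x\<in>topspace X. \<bar>f x\<bar> \<le> M"
      using pseudocompact_bound[OF assms f] by blast
    obtain N where N: "N > 0" "\<forall>x\<in>topspace X. \<bar>g x\<bar> \<le> N"
      using pseudocompact_bound[OF assms g] by blast
    obtain \<delta> where \<delta>: "\<delta> > 0"
      "\<And>a a' b b'. \<bar>a\<bar> \<le> max M N \<Longrightarrow> \<bar>b\<bar> \<le> max M N \<Longrightarrow> \<bar>a - a'\<bar> < \<delta> \<Longrightarrow> \<bar>b - b'\<bar> < \<delta> \<Longrightarrow>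
       \<bar>a * b - a' * b'\<bar> \<le> \<epsilon>"
      using mult_uniformly_close[of "max M N" \<epsilon>] M(1) \<epsilon> by (metis less_max_iff_disj)
    have "\<bar>(f \<otimes>\<^bsub>Cc X\<^esub> g) x - (f' \<otimes>\<^bsub>Cc X\<^esub> g') x\<bar> \<le> \<epsilon>"
      if "f' \<in> Uc_nbhd X f \<delta>" "g' \<in> Uc_nbhd X g \<delta>" "x \<in> topspace X" for f' g' x
      using \<delta>(2)[of "f x" "g x" "f' x" "g' x"] bspec[OF M(2) that(3)] bspec[OF N(2) that(3)]
        Uc_nbhdD(2)[OF that(1,3)] Uc_nbhdD(2)[OF that(2,3)] that(3)
      by (simp add: Cc_select)
    with f \<delta>(1) show "\<exists>W \<delta>. openin (Uc_topology X) W \<and> f \<in> W \<and> \<delta> > 0 \<and>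
      (\<forall>f'\<in>W. \<forall>g'\<in>Uc_nbhd X g \<delta>. \<forall>x\<in>topspace X.
         \<bar>(f \<otimes>\<^bsub>Cc X\<^esub> g) x - (f' \<otimes>\<^bsub>Cc X\<^esub> g') x\<bar> \<le> \<epsilon>)"
      by (intro exI[of _ "Uc_nbhd X f \<delta>"] exI[of _ \<delta>])
        (auto simp: openin_Uc_nbhd centre_in_Uc_nbhd)
  qed
  then show ?thesis
    by (simp add: topological_ring_def cring.axioms(1) cring_Cc topspace_Uc_topology
        continuous_add_Uc continuous_a_inv_Uc)
qed

lemma pseudocompact_imp_topological_vector_space:
  assumes "pseudocompact_space X"
  shows "real_topological_vector_space (Cc X) (Uc_topology X)"
proof -
  have "continuous_map (prod_topology euclideanreal (Uc_topology X)) (Uc_topology X)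
     (\<lambda>(c, f). c \<odot>\<^bsub>Cc X\<^esub> f)"
  proof (rule continuous_map_Uc_prodI)
    fix c \<epsilon> :: real and f
    assume f: "f \<in> carrier (Cc X)"
    then show "c \<odot>\<^bsub>Cc X\<^esub> f \<in> carrier (Cc X)"
      by (simp add: Cc_select scale_in_Cc)
    assume \<epsilon>: "\<epsilon> > 0"
    obtain M where M: "M > 0" "\<forall>x\<in>topspace X. \<bar>f x\<bar> \<le> M"
      using pseudocompact_bound[OF assms f] by blast
    \<comment> \<open>The scalar \<open>c\<close> plays the part of a first factor bounded by its
      own absolute value.\<close>
    obtain \<delta> where \<delta>: "\<delta> > 0"
      "\<And>a a' b b'. \<bar>a\<bar> \<le> max M \<bar>c\<bar> \<Longrightarrow> \<bar>b\<bar> \<le> max M \<bar>c\<bar> \<Longrightarrow> \<bar>a - a'\<bar> < \<delta> \<Longrightarrow> \<bar>b - b'\<bar> < \<delta> \<Longrightarrow>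
       \<bar>a * b - a' * b'\<bar> \<le> \<epsilon>"
      using mult_uniformly_close[of "max M \<bar>c\<bar>" \<epsilon>] M(1) \<epsilon> by (metis less_max_iff_disj)
    have "\<bar>(c \<odot>\<^bsub>Cc X\<^esub> f) x - (d \<odot>\<^bsub>Cc X\<^esub> g) x\<bar> \<le> \<epsilon>"
      if "d \<in> ball c \<delta>" "g \<in> Uc_nbhd X f \<delta>" "x \<in> topspace X" for d g x
      using \<delta>(2)[of c "f x" d "g x"] bspec[OF M(2) that(3)] that(1,3) Uc_nbhdD(2)[OF that(2,3)]
      by (simp add: Cc_select dist_real_def)
    with \<delta>(1) show "\<exists>W \<delta>. openin euclideanreal W \<and> c \<in> W \<and> \<delta> > 0 \<and>
      (\<forall>d\<in>W. \<forall>g\<in>Uc_nbhd X f \<delta>. \<forall>x\<in>topspace X.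
         \<bar>(c \<odot>\<^bsub>Cc X\<^esub> f) x - (d \<odot>\<^bsub>Cc X\<^esub> g) x\<bar> \<le> \<epsilon>)"
      by (intro exI[of _ "ball c \<delta>"] exI[of _ \<delta>]) auto
  qed
  then show ?thesis
    by (simp add: real_topological_vector_space_def module_Cc topspace_Uc_topology continuous_add_Uc)
qed

text \<open>The inverse of a unit \<open>f\<close> is bounded, say by \<open>M\<close>, so
  \<open>f\<close> stays at distance at least \<open>1 / M\<close> from 0, and no function closer to
  \<open>f\<close> than that can vanish.\<close>

lemma pseudocompact_imp_open_Units:
  assumes "pseudocompact_space X"
  shows "openin (Uc_topology X) (Units (Cc X))"
  unfolding openin_Uc_iff Units_Cc
proof (intro conjI ballI)
  fix f assume f: "f \<in> {f \<in> carrier (Cc X). \<forall>x\<in>topspace X. f x \<noteq> 0}"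
  then have inv: "(\<lambda>x\<in>topspace X. inverse (f x)) \<in> carrier (Cc X)"
    by (intro inverse_in_Cc) auto
  obtain M where "M > 0" "\<forall>x\<in>topspace X. \<bar>(\<lambda>x\<in>topspace X. inverse (f x)) x\<bar> \<le> M"
    using pseudocompact_bound[OF assms inv] by blast
  then have M: "M > 0" "\<And>x. x \<in> topspace X \<Longrightarrow> \<bar>inverse (f x)\<bar> \<le> M"
    by simp_all
  have "1 / M \<le> \<bar>f x\<bar>" if "x \<in> topspace X" for x
    using M(2)[OF that] M(1) f that by (auto simp: field_simps)
  then have "g x \<noteq> 0" if "g \<in> Uc_nbhd X f (1 / M)" "x \<in> topspace X" for g x
    using Uc_nbhdD(2)[OF that] that(2) by fastforce
  with M(1) show "\<exists>\<epsilon>>0. Uc_nbhd X f \<epsilon> \<subseteq> {f \<in> carrier (Cc X). \<forall>x\<in>topspace X. f x \<noteq> 0}"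
    by (intro exI[of _ "1 / M"]) (auto dest: Uc_nbhdD(1))
qed auto

section \<open>Spaces that are not pseudocompact\<close>

lemma continuous_map_locally_constant:
  assumes "\<And>x. x \<in> topspace X \<Longrightarrow> f x \<in> topspace Y"
    and "\<And>x. x \<in> topspace X \<Longrightarrow> \<exists>U. openin X U \<and> x \<in> U \<and> (\<forall>y\<in>U. f y = f x)"
  shows "continuous_map X Y f"
  unfolding continuous_map_eq_topcontinuous_at topcontinuous_at_def
proof (intro ballI conjI allI impI)
  fix x V assume x: "x \<in> topspace X" and V: "openin Y V \<and> f x \<in> V"
  from assms(2)[OF x] obtain U where "openin X U" "x \<in> U" "\<forall>y\<in>U. f y = f x" by blast
  with V show "\<exists>U. openin X U \<and> x \<in> U \<and> (\<forall>y\<in>U. f y \<in> V)"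
    by metis
qed (use assms(1) in auto)

text \<open>The sum of the functions \<open>n\<close> times the indicator of \<open>U n\<close> is
  integer-valued, hence of countable range, and locally constant because \<open>h\<close> is locally
  bounded. Nonnegativity is there to make \<open>1 + g\<close> a unit later.\<close>

lemma not_pseudocompact_unbounded_Cc:
  assumes "zero_dimensional_space X" and "\<not> pseudocompact_space X"
  shows "\<exists>g\<in>carrier (Cc X). (\<forall>x\<in>topspace X. 0 \<le> g x) \<and> (\<forall>M. \<exists>x\<in>topspace X. M < g x)"
proof -
  from assms(2) obtain f where f: "continuous_map X euclideanreal f" "\<not> bounded (f ` topspace X)"
    by (auto simp: pseudocompact_space_def)
  define h where "h = (\<lambda>x. \<bar>f x\<bar>)"
  have h: "continuous_map X euclideanreal h"
    unfolding h_def using f(1) by (rule continuous_map_real_abs)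
  have "\<exists>U. openin X U \<and> closedin X U \<and> (\<exists>x\<in>topspace X. x \<in> U) \<and> (\<forall>y\<in>U. real n < h y)" for n
  proof -
    obtain x where x: "x \<in> topspace X" "real n < h x"
      using f(2) by (force simp: bounded_iff h_def not_le)
    have "openin X {y \<in> topspace X. h y \<in> {real n<..}}"
      by (rule openin_continuous_map_preimage[OF h]) (auto simp flip: open_openin)
    with x assms(1) obtain U where "openin X U" "closedin X U" "x \<in> U"
      "U \<subseteq> {y \<in> topspace X. h y \<in> {real n<..}}"
      unfolding zero_dimensional_space_def arbitrary_union_of_alt
      by (metis (mono_tags, lifting) greaterThan_iff mem_Collect_eq)
    with x(1) show ?thesis
      by (intro exI[of _ U]) auto
  qed
  then obtain U where oU: "\<And>n. openin X (U n)" and cU: "\<And>n. closedin X (U n)"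
    and neU: "\<And>n. \<exists>x\<in>topspace X. x \<in> U n" and hU: "\<And>n y. y \<in> U n \<Longrightarrow> real n < h y"
    by metis
  define s where "s = (\<lambda>x. \<Sum>n | x \<in> U n. n)"
  \<comment> \<open>A sum over an infinite set would default to 0; finiteness is what makes each
    member of the index set a lower bound for \<open>s x\<close>.\<close>
  have fin: "finite {n. x \<in> U n}" for x
  proof (rule finite_subset)
    show "{n. x \<in> U n} \<subseteq> {..nat \<lceil>h x\<rceil>}"
    proof safe
      fix n assume "x \<in> U n"
      then have "real n < h x" by (rule hU)
      then show "n \<le> nat \<lceil>h x\<rceil>" by linarith
    qed
  qed simp
  have "continuous_map X euclideanreal (\<lambda>x. real (s x))"
  proof (rule continuous_map_locally_constant)
    fix x assume x: "x \<in> topspace X"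
    \<comment> \<open>The added 1 makes \<open>h x < N\<close> strict, so that \<open>x\<close> lies
      in \<open>V\<close>, and keeps the index set \<open>{..<N}\<close> nonempty, as
      \<open>openin_INT2\<close> requires.\<close>
    define N where "N = nat \<lceil>h x\<rceil> + 1"
    have N: "h x < real N" unfolding N_def by linarith
    \<comment> \<open>On \<open>V\<close> membership in each \<open>U n\<close> with
      \<open>n < N\<close> is decided as at \<open>x\<close>, an open condition either way since
      \<open>U n\<close> is clopen. For \<open>n \<ge> N\<close> no point of \<open>V\<close> lies
      in \<open>U n\<close>, as \<open>h\<close> would exceed \<open>n\<close> there.\<close>
    define V where "V = {y \<in> topspace X. h y \<in> {..<real N}} \<inter>
      (\<Inter>n\<in>{..<N}. if x \<in> U n then U n else topspace X - U n)"
    have "openin X V"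
      unfolding V_def
    proof (intro openin_Int openin_continuous_map_preimage[OF h] openin_INT2)
      show "openin X (if x \<in> U n then U n else topspace X - U n)" for n
        using oU cU by auto
    qed (auto simp: N_def simp flip: open_openin)
    moreover have "x \<in> V"
      using x N by (auto simp: V_def)
    moreover have "s y = s x" if y: "y \<in> V" for y
    proof -
      have "n < N" if "y \<in> U n \<or> x \<in> U n" for n
        using that y N hU[of x n] hU[of y n] by (auto simp: V_def)
      moreover have "y \<in> U n \<longleftrightarrow> x \<in> U n" if "n < N" for n
        using y that by (auto simp: V_def split: if_splits)
      ultimately have "y \<in> U n \<longleftrightarrow> x \<in> U n" for n by blast
      then show ?thesis by (simp add: s_def)
    qed
    ultimately show "\<exists>U. openin X U \<and> x \<in> U \<and> (\<forall>y\<in>U. real (s y) = real (s x))"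
      by metis
  qed simp
  moreover have "countable ((\<lambda>x. real (s x)) ` topspace X)"
    by (rule countable_subset[of _ "range real"]) auto
  ultimately have mem: "(\<lambda>x\<in>topspace X. real (s x)) \<in> carrier (Cc X)"
    by (rule restrict_in_Cc)
  have "\<exists>x\<in>topspace X. M < real (s x)" for M
  proof -
    obtain n where n: "M < real n" using reals_Archimedean2 by blast
    obtain x where x: "x \<in> topspace X" "x \<in> U n" using neU by blast
    have "n \<le> s x"
      unfolding s_def using fin x(2) member_le_sum[of n "{n. x \<in> U n}" "\<lambda>n. n"] by simp
    with n x show ?thesis by force
  qed
  then show ?thesis
    by (intro bexI[OF _ mem]) simp
qed

section \<open>An unbounded function refutes each of the three properties\<close>

lemma not_small_multiple_of_unbounded:
  fixes g :: "'a \<Rightarrow> real"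
  assumes "\<And>M. \<exists>x\<in>A. M < g x" and "c > 0"
  shows "\<exists>x\<in>A. 1 < c * g x"
proof -
  obtain x where "x \<in> A" "1 / c < g x" using assms(1) by blast
  with assms(2) show ?thesis by (auto simp: field_simps)
qed

text \<open>Multiplication by the fixed unbounded \<open>g\<close> would be continuous at 0, yet
  arbitrarily small constants times \<open>g\<close> leave the unit ball.\<close>

lemma topological_ring_imp_pseudocompact:
  assumes "zero_dimensional_space X" and "topological_ring (Cc X) (Uc_topology X)"
  shows "pseudocompact_space X"
proof (rule ccontr)
  let ?T = "Uc_topology X"
  assume "\<not> pseudocompact_space X"
  from not_pseudocompact_unbounded_Cc[OF assms(1) this] obtain g
    where "g \<in> carrier (Cc X)" "\<forall>M. \<exists>x\<in>topspace X. M < g x"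
    by blast
  then have g: "g \<in> carrier (Cc X)" "\<And>M. \<exists>x\<in>topspace X. M < g x"
    by simp_all
  let ?z = "\<lambda>x\<in>topspace X. 0::real"
  have "continuous_map ?T ?T ((\<lambda>(f, g). f \<otimes>\<^bsub>Cc X\<^esub> g) \<circ> (\<lambda>f. (f, g)))"
  proof (rule continuous_map_compose)
    show "continuous_map ?T (prod_topology ?T ?T) (\<lambda>f. (f, g))"
      using g(1) by (intro continuous_map_pairedI) (auto simp: topspace_Uc_topology)
    show "continuous_map (prod_topology ?T ?T) ?T (\<lambda>(f, g). f \<otimes>\<^bsub>Cc X\<^esub> g)"
      using assms(2) by (simp add: topological_ring_def)
  qed
  then have "openin ?T {f \<in> topspace ?T. ((\<lambda>(f, g). f \<otimes>\<^bsub>Cc X\<^esub> g) \<circ> (\<lambda>f. (f, g))) f \<in> Uc_nbhd X ?z 1}"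
    by (rule openin_continuous_map_preimage) (simp add: openin_Uc_nbhd const_in_Cc)
  then have op: "openin ?T {f \<in> carrier (Cc X). f \<otimes>\<^bsub>Cc X\<^esub> g \<in> Uc_nbhd X ?z 1}"
    by (simp add: topspace_Uc_topology)
  have "?z \<otimes>\<^bsub>Cc X\<^esub> g = ?z"
    by (auto simp: Cc_select intro: restrict_ext)
  then have "?z \<in> {f \<in> carrier (Cc X). f \<otimes>\<^bsub>Cc X\<^esub> g \<in> Uc_nbhd X ?z 1}"
    using const_in_Cc[of 0 X] by (simp add: centre_in_Uc_nbhd)
  with op obtain \<epsilon> where \<epsilon>: "\<epsilon> > 0"
    "Uc_nbhd X ?z \<epsilon> \<subseteq> {f \<in> carrier (Cc X). f \<otimes>\<^bsub>Cc X\<^esub> g \<in> Uc_nbhd X ?z 1}"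
    unfolding openin_Uc_iff by blast
  \<comment> \<open>The constant \<epsilon> itself would sit on the boundary of the open ball, hence
    the half.\<close>
  have "(\<lambda>x\<in>topspace X. \<epsilon> / 2) \<in> Uc_nbhd X ?z \<epsilon>"
    using \<epsilon>(1) by (intro Uc_nbhdI[where r = "\<epsilon> / 2"] const_in_Cc) auto
  then have "(\<lambda>x\<in>topspace X. \<epsilon> / 2) \<otimes>\<^bsub>Cc X\<^esub> g \<in> Uc_nbhd X ?z 1"
    using \<epsilon>(2) by blast
  then have "\<epsilon> / 2 * g x < 1" if "x \<in> topspace X" for x
    using Uc_nbhdD(2) that by (fastforce simp: Cc_select)
  with not_small_multiple_of_unbounded[OF g(2), of "\<epsilon> / 2"] \<epsilon>(1) show False by force
qed

text \<open>Here the small constants are scalars, and continuity fails along the line of multiples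
  of \<open>g\<close>.\<close>

lemma topological_vector_space_imp_pseudocompact:
  assumes "zero_dimensional_space X" and "real_topological_vector_space (Cc X) (Uc_topology X)"
  shows "pseudocompact_space X"
proof (rule ccontr)
  let ?T = "Uc_topology X"
  assume "\<not> pseudocompact_space X"
  from not_pseudocompact_unbounded_Cc[OF assms(1) this] obtain g
    where "g \<in> carrier (Cc X)" "\<forall>M. \<exists>x\<in>topspace X. M < g x"
    by blast
  then have g: "g \<in> carrier (Cc X)" "\<And>M. \<exists>x\<in>topspace X. M < g x"
    by simp_all
  let ?z = "\<lambda>x\<in>topspace X. 0::real"
  have "continuous_map euclideanreal ?T ((\<lambda>(c, f). c \<odot>\<^bsub>Cc X\<^esub> f) \<circ> (\<lambda>c. (c, g)))"
  proof (rule continuous_map_compose)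
    show "continuous_map euclideanreal (prod_topology euclideanreal ?T) (\<lambda>c. (c, g))"
      using g(1) by (intro continuous_map_pairedI) (auto simp: topspace_Uc_topology)
    show "continuous_map (prod_topology euclideanreal ?T) ?T (\<lambda>(c, f). c \<odot>\<^bsub>Cc X\<^esub> f)"
      using assms(2) by (simp add: real_topological_vector_space_def)
  qed
  then have "openin euclideanreal
      {c \<in> topspace euclideanreal. ((\<lambda>(c, f). c \<odot>\<^bsub>Cc X\<^esub> f) \<circ> (\<lambda>c. (c, g))) c \<in> Uc_nbhd X ?z 1}"
    by (rule openin_continuous_map_preimage) (simp add: openin_Uc_nbhd const_in_Cc)
  then have op: "open {c. c \<odot>\<^bsub>Cc X\<^esub> g \<in> Uc_nbhd X ?z 1}"
    by simp
  have "0 \<odot>\<^bsub>Cc X\<^esub> g = ?z"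
    by (auto simp: Cc_select intro: restrict_ext)
  then have "0 \<in> {c. c \<odot>\<^bsub>Cc X\<^esub> g \<in> Uc_nbhd X ?z 1}"
    using const_in_Cc[of 0 X] by (simp add: centre_in_Uc_nbhd)
  \<comment> \<open>With a closed ball the scalar \<epsilon> itself is available.\<close>
  with op obtain \<epsilon> where \<epsilon>: "\<epsilon> > 0" "cball 0 \<epsilon> \<subseteq> {c. c \<odot>\<^bsub>Cc X\<^esub> g \<in> Uc_nbhd X ?z 1}"
    by (meson open_contains_cball)
  then have "\<epsilon> \<odot>\<^bsub>Cc X\<^esub> g \<in> Uc_nbhd X ?z 1"
    using subsetD[OF \<epsilon>(2), of \<epsilon>] by simp
  then have "\<epsilon> * g x < 1" if "x \<in> topspace X" for x
    using Uc_nbhdD(2) that by (fastforce simp: Cc_select)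
  with not_small_multiple_of_unbounded[OF g(2) \<epsilon>(1)] show False by force
qed

text \<open>The unit \<open>u = 1 / (1 + g)\<close> takes arbitrarily small positive values;
  subtracting such a value moves \<open>u\<close> only slightly and creates a zero.\<close>

lemma open_Units_imp_pseudocompact:
  assumes "zero_dimensional_space X" and "openin (Uc_topology X) (Units (Cc X))"
  shows "pseudocompact_space X"
proof (rule ccontr)
  assume "\<not> pseudocompact_space X"
  from not_pseudocompact_unbounded_Cc[OF assms(1) this] obtain g
    where "g \<in> carrier (Cc X)" "\<forall>x\<in>topspace X. 0 \<le> g x" "\<forall>M. \<exists>x\<in>topspace X. M < g x"
    by blast
  then have g: "g \<in> carrier (Cc X)" "\<And>x. x \<in> topspace X \<Longrightarrow> 0 \<le> g x"
    "\<And>M. \<exists>x\<in>topspace X. M < g x"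
    by simp_all
  define k where "k = (\<lambda>x\<in>topspace X. g x + (\<lambda>x\<in>topspace X. 1) x)"
  have k: "k \<in> carrier (Cc X)"
    unfolding k_def by (intro add_in_Cc g(1) const_in_Cc)
  have kx: "k x = g x + 1" "k x > 0" if "x \<in> topspace X" for x
    using that g(2)[OF that] by (auto simp: k_def)
  define u where "u = (\<lambda>x\<in>topspace X. inverse (k x))"
  have u: "u \<in> carrier (Cc X)"
    unfolding u_def using k kx(2) by (intro inverse_in_Cc) force+
  have ux: "u x = inverse (k x)" if "x \<in> topspace X" for x
    using that by (simp add: u_def)
  have "u \<in> Units (Cc X)"
    using u ux kx(2) by (force simp: Units_Cc)
  with assms(2) obtain \<epsilon> where \<epsilon>: "\<epsilon> > 0" "Uc_nbhd X u \<epsilon> \<subseteq> Units (Cc X)"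
    unfolding openin_Uc_iff by blast
  \<comment> \<open>The choice gives \<open>\<epsilon> * (1 + g p) > 1\<close>, which is
    \<open>u p < \<epsilon>\<close>.\<close>
  obtain p where p: "p \<in> topspace X" "1 < \<epsilon> * g p"
    using not_small_multiple_of_unbounded[OF g(3) \<epsilon>(1)] by blast
  have up: "0 < u p" "u p < \<epsilon>"
    using p kx[OF p(1)] \<epsilon>(1) by (auto simp: ux field_simps)
  define v where "v = (\<lambda>x\<in>topspace X. u x + (\<lambda>x\<in>topspace X. - u p) x)"
  have "v \<in> carrier (Cc X)"
    unfolding v_def by (intro add_in_Cc u const_in_Cc)
  \<comment> \<open>The difference of \<open>u\<close> and \<open>v\<close> is the constant
    \<open>u p\<close>, while \<open>v\<close> vanishes at \<open>p\<close>.\<close>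
  then have "v \<in> Uc_nbhd X u \<epsilon>"
    using up by (intro Uc_nbhdI[where r = "u p"]) (auto simp: v_def)
  with \<epsilon>(2) have "v p \<noteq> 0"
    using p(1) by (auto simp: Units_Cc)
  with p(1) show False by (simp add: v_def)
qed

theorem theorem5p2:
  fixes X :: "'a topology"
  assumes "Hausdorff_space X" and "zero_dimensional_space X"
  shows "(pseudocompact_space X \<longleftrightarrow> topological_ring (Cc X) (Uc_topology X)) \<and>
         (pseudocompact_space X \<longleftrightarrow> real_topological_vector_space (Cc X) (Uc_topology X)) \<and>
         (pseudocompact_space X \<longleftrightarrow> openin (Uc_topology X) (Units (Cc X)))"
  using pseudocompact_imp_topological_ring[of X] topological_ring_imp_pseudocompact[OF assms(2)]
    pseudocompact_imp_topological_vector_space[of X]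
    topological_vector_space_imp_pseudocompact[OF assms(2)]
    pseudocompact_imp_open_Units[of X] open_Units_imp_pseudocompact[OF assms(2)]
  by blast

end
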